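(* Consider the minimum delay routing problem with mutual information accumulation (as defined in the context), and suppose it has an optimal solution. Then, under the optimal solution, in each stage it is optimal for only one node to transmit, and in stage $j$ that node is node $j$. Precisely: there is an optimal solution, consisting of a relay set $\mathcal{R}_{opt}$ with $|\mathcal{R}_{opt}| = k$, an ordering $\mathcal{O}_{opt}$ of $\mathcal{R}_{opt}$ (with nodes labeled $0,1,\ldots,k,k+1$ according to the ordering, $0$ being the source and $k+1$ the destination), and durations $(A_{ij})$, $(\Delta_j)$, in which each node of $\mathcal{R}_{opt}$ transmits for a non-zero total duration and such that for every stage $j\in\{0,1,\ldots,k\}$ one has $A_{ij}=0$ for all $i\neq j$.
   Context: Network: a source $s$, a destination $d$, and $n$ relay nodes. For each ordered pair of distinct nodes $(i,j)$ there is a fixed link capacity $C_{ij}\ge 0$ (transmit powers are fixed, bandwidth is normalized to $1$): if node $i$ transmits for a duration $\Delta$, every other node $j$ that does not yet have the packet accumulates $\Delta\, C_{ij}$ bits of mutual information, and contributions from different transmissions add up. A node can transmit only after it has decoded the packet, which requires accumulating at least $I_{max}>0$ bits. Initially only $s$ has the packet. Transmissions are orthogonal in time (at most one node transmits at any moment). A transmission strategy uses a subset $\mathcal{R}$ of the relays, $|\mathcal{R}|=k$, and an ordering $\mathcal{O}$ of $\mathcal{R}$ (the decoding order). Label the relays of $\mathcal{R}$ as $1,2,\ldots,k$ according to $\mathcal{O}$, the source as $0$ and the destination as $k+1$. Let $t_0$ be the start time and $t_m$ the decoding time of node $m$, $t_0\le t_1\le\cdots\le t_{k+1}$. Stage $j$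 ($0\le j\le k$) is the interval $[t_j,t_{j+1}]$, with duration $\Delta_j=t_{j+1}-t_j$, and $A_{ij}$ is the transmission duration of node $i$ in stage $j$. For given $(\mathcal{R},\mathcal{O})$ the minimum delay is the value of the linear program $$\text{minimize } T_{tot}=\sum_{j=0}^k\Delta_j$$ subject to $$\sum_{i=0}^{m-1}\sum_{j=0}^{m-1}A_{ij}C_{im}\ge I_{max}\ \ \forall m\in\{1,\ldots,k+1\},\qquad \sum_{i=0}^{j}A_{ij}\le\Delta_j\ \ \forall j\in\{0,\ldots,k\},$$ $$A_{ij}\ge 0\ \ \forall i,j\in\{0,\ldots,k\},\qquad A_{ij}=0\ \ \forall i>j,\qquad \Delta_j\ge 0\ \ \forall j\in\{0,\ldots,k\}.$$ The minimum delay routing problem is to minimize $T_{tot}$ over all relay subsets $\mathcal{R}$ (including the empty set), all orderings $\mathcal{O}$ of $\mathcal{R}$, and all feasible $(A_{ij}),(\Delta_j)$. An optimal solution is a choice $(\mathcal{R},\mathcal{O},(A_{ij}),(\Delta_j))$ attaining this overall minimum. The set $\mathcal{R}_{opt}$ of relays taking part in an optimal solution is, by definition, such that each of its nodes transmits for a non-zero duration (a relay that never transmits can be removed from the set without affecting the minimum delay). *)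

theory Defs
  imports Complex_Main
begin

text \<open>
  A pair of a relay subset and a decoding order of it is a set \<open>R\<close> together with a list \<open>os\<close>
  enumerating \<open>R\<close> without repetition. The label of a node is its position in the list
  \<open>s # os @ [d]\<close>: the source gets \<open>0\<close>, the relays \<open>1, \<dots>, k\<close> and the destination \<open>k + 1\<close>.
\<close>

definition relay_ordering :: "'a set \<Rightarrow> 'a set \<Rightarrow> 'a list \<Rightarrow> bool" where
  "relay_ordering relays R os \<longleftrightarrow> R \<subseteq> relays \<and> distinct os \<and> set os = R"

definition node :: "'a \<Rightarrow> 'a \<Rightarrow> 'a list \<Rightarrow> nat \<Rightarrow> 'a" where
  "node s d os m = (s # os @ [d]) ! m"

text \<open>
  The linear program for a fixed decoding order. \<open>A i j\<close> is the transmission duration of the node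
  labelled \<open>i\<close> in stage \<open>j\<close>, and \<open>\<Delta> j\<close> is the duration of stage \<open>j\<close>. Only the values at
  indices in \<open>{0..k}\<close> are meaningful; all others are unconstrained and never used.
\<close>

definition lp_feasible ::
  "('a \<Rightarrow> 'a \<Rightarrow> real) \<Rightarrow> real \<Rightarrow> 'a \<Rightarrow> 'a \<Rightarrow> 'a list \<Rightarrow> (nat \<Rightarrow> nat \<Rightarrow> real) \<Rightarrow> (nat \<Rightarrow> real) \<Rightarrow> bool"
where
  "lp_feasible C Imax s d os A \<Delta> \<longleftrightarrow>
     (let k = length os in
       (\<forall>m\<in>{1..k+1}. (\<Sum>i=0..m-1. \<Sum>j=0..m-1. A i j * C (node s d os i) (node s d os m)) \<ge> Imax) \<and>
       (\<forall>j\<in>{0..k}. (\<Sum>i=0..j. A i j) \<le> \<Delta> j) \<and>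
       (\<forall>i\<in>{0..k}. \<forall>j\<in>{0..k}. A i j \<ge> 0) \<and>
       (\<forall>i\<in>{0..k}. \<forall>j\<in>{0..k}. i > j \<longrightarrow> A i j = 0) \<and>
       (\<forall>j\<in>{0..k}. \<Delta> j \<ge> 0))"

definition total_delay :: "'a list \<Rightarrow> (nat \<Rightarrow> real) \<Rightarrow> real" where
  "total_delay os \<Delta> = (\<Sum>j=0..length os. \<Delta> j)"

definition feasible_solution ::
  "'a set \<Rightarrow> ('a \<Rightarrow> 'a \<Rightarrow> real) \<Rightarrow> real \<Rightarrow> 'a \<Rightarrow> 'a \<Rightarrow>
   'a set \<Rightarrow> 'a list \<Rightarrow> (nat \<Rightarrow> nat \<Rightarrow> real) \<Rightarrow> (nat \<Rightarrow> real) \<Rightarrow> bool"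
where
  "feasible_solution relays C Imax s d R os A \<Delta> \<longleftrightarrow>
     relay_ordering relays R os \<and> lp_feasible C Imax s d os A \<Delta>"

definition optimal_solution ::
  "'a set \<Rightarrow> ('a \<Rightarrow> 'a \<Rightarrow> real) \<Rightarrow> real \<Rightarrow> 'a \<Rightarrow> 'a \<Rightarrow>
   'a set \<Rightarrow> 'a list \<Rightarrow> (nat \<Rightarrow> nat \<Rightarrow> real) \<Rightarrow> (nat \<Rightarrow> real) \<Rightarrow> bool"
where
  "optimal_solution relays C Imax s d R os A \<Delta> \<longleftrightarrow>
     feasible_solution relays C Imax s d R os A \<Delta> \<and>
     (\<forall>R' os' A' \<Delta>'. feasible_solution relays C Imax s d R' os' A' \<Delta>' \<longrightarrow>
        total_delay os \<Delta> \<le> total_delay os' \<Delta>')"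

end

theory Submission
  imports Defs
begin

text \<open>
  For a fixed decoding order, a node may shift everything it transmits to its own stage: each later
  node then hears at least as much before its decoding time, and the total duration is unchanged.
  Once each node transmits only in its own stage, a silent relay can be dropped from the order
  without affecting anyone else. An optimal diagonal solution with the fewest relays is therefore
  as claimed.
\<close>

text \<open>The single vector \<open>b\<close> serves both as the transmission durations and as the
  stage durations, so a strategy in which each node sends only in its own stage is determined by
  \<open>b\<close> alone.\<close>

definition diag :: "(nat \<Rightarrow> real) \<Rightarrow> nat \<Rightarrow> nat \<Rightarrow> real" where
  "diag b i j = (if i = j then b i else 0)"

text \<open>Causality and the stage constraints hold automatically for \<open>diag b\<close>, the
  latter with equality. What remains is a triangular system in \<open>b\<close>, with no stage
  index.\<close>

lemma lp_feasible_diag_iff: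
  "lp_feasible C Imax s d os (diag b) b \<longleftrightarrow>
     (\<forall>m\<in>{1..length os + 1}. (\<Sum>i<m. b i * C (node s d os i) (node s d os m)) \<ge> Imax) \<and>
     (\<forall>j\<le>length os. b j \<ge> 0)"
proof -
  have "(\<Sum>i=0..m-1. \<Sum>j=0..m-1. diag b i j * C (node s d os i) (node s d os m)) =
        (\<Sum>i<m. b i * C (node s d os i) (node s d os m))" if "m \<ge> 1" for m
  proof -
    have eq: "{0..m-1} = {..<m}" using that by auto
    show ?thesis unfolding eq
      by (intro sum.cong refl) (simp add: diag_def if_distrib[of "\<lambda>x. x * _"] cong: if_cong)
  qed
  moreover have "(\<Sum>i=0..j. diag b i j) = b j" for j
    by (simp add: diag_def)
  ultimately show ?thesis
    unfolding lp_feasible_def Let_def by (auto simp: diag_def)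
qed

lemma node_in_nodes:
  "i \<le> length os + 1 \<Longrightarrow> node s d os i \<in> insert s (insert d (set os))"
  unfolding node_def using nth_mem[of i "s # os @ [d]"] by auto

lemma node_inject:
  assumes "distinct os" "s \<notin> set os" "d \<notin> set os" "s \<noteq> d"
    and "i \<le> length os + 1" "j \<le> length os + 1"
  shows "node s d os i = node s d os j \<longleftrightarrow> i = j"
  unfolding node_def using assms by (intro nth_eq_iff_index_eq) auto

text \<open>The constraint of node \<open>m\<close> counts what \<open>i\<close> sends in stages
  before \<open>m\<close>, whereas \<open>b i\<close> collects all stages of \<open>i\<close> and is
  spent entirely in stage \<open>i < m\<close>. As capacities are non-negative, no constraint gets
  weaker.\<close>

lemma lp_feasible_diagonalize:
  assumes feas: "lp_feasible C Imax s d os A \<Delta>"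
    and C: "\<And>i m. i < m \<Longrightarrow> m \<le> length os + 1 \<Longrightarrow> C (node s d os i) (node s d os m) \<ge> 0"
  defines "b \<equiv> \<lambda>i. \<Sum>j=0..length os. A i j"
  shows "lp_feasible C Imax s d os (diag b) b" and "total_delay os b \<le> total_delay os \<Delta>"
proof -
  let ?k = "length os" and ?c = "\<lambda>i m. C (node s d os i) (node s d os m)"
  have mi: "(\<Sum>i=0..m-1. \<Sum>j=0..m-1. A i j * ?c i m) \<ge> Imax" if "m \<in> {1..?k+1}" for m
    using feas that unfolding lp_feasible_def Let_def by blast
  have stage: "(\<Sum>i=0..j. A i j) \<le> \<Delta> j" if "j \<le> ?k" for j
    using feas that unfolding lp_feasible_def Let_def by auto
  have A_nonneg: "A i j \<ge> 0" if "i \<le> ?k" "j \<le> ?k" for i j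
    using feas that unfolding lp_feasible_def Let_def by auto
  have A_causal: "A i j = 0" if "i \<le> ?k" "j \<le> ?k" "i > j" for i j
    using feas that unfolding lp_feasible_def Let_def by auto
  have "(\<Sum>i<m. b i * ?c i m) \<ge> Imax" if m: "m \<in> {1..?k+1}" for m
  proof -
    have eq: "{0..m-1} = {..<m}" using m by auto
    have "(\<Sum>i<m. \<Sum>j<m. A i j * ?c i m) \<le> (\<Sum>i<m. b i * ?c i m)"
    proof (rule sum_mono)
      fix i assume i: "i \<in> {..<m}"
      have "(\<Sum>j<m. A i j) \<le> b i"
        unfolding b_def using m i by (intro sum_mono2) (auto intro!: A_nonneg)
      then have "(\<Sum>j<m. A i j) * ?c i m \<le> b i * ?c i m"
        using C[of i m] m i by (intro mult_right_mono) auto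
      then show "(\<Sum>j<m. A i j * ?c i m) \<le> b i * ?c i m"
        by (simp add: sum_distrib_right)
    qed
    with mi[OF m] show ?thesis unfolding eq by linarith
  qed
  moreover have "b j \<ge> 0" if "j \<le> ?k" for j
    unfolding b_def using that by (auto intro!: sum_nonneg A_nonneg)
  ultimately show "lp_feasible C Imax s d os (diag b) b"
    unfolding lp_feasible_diag_iff by blast
  have "total_delay os b = (\<Sum>j=0..?k. \<Sum>i=0..?k. A i j)"
    unfolding total_delay_def b_def by (rule sum.swap)
  \<comment> \<open>By causality, stage \<open>j\<close> contains only transmissions of nodes up to
    \<open>j\<close>, so the stage constraint bounds each inner sum.\<close>
  also have "\<dots> = (\<Sum>j=0..?k. \<Sum>i=0..j. A i j)"
    by (intro sum.cong refl sum.mono_neutral_right) (auto intro: A_causal)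
  also have "\<dots> \<le> total_delay os \<Delta>"
    unfolding total_delay_def by (intro sum_mono stage) auto
  finally show "total_delay os b \<le> total_delay os \<Delta>" .
qed

text \<open>The increasing enumeration of the naturals other than \<open>p\<close>: it sends a label
  in the order without relay \<open>p\<close> back to its label in the original order.\<close>

definition skip :: "nat \<Rightarrow> nat \<Rightarrow> nat" where
  "skip p i = (if i < p then i else Suc i)"

lemma inj_skip: "inj (skip p)"
  by (auto simp: inj_def skip_def split: if_splits)

text \<open>The bound \<open>skip p m\<close> covers two cases: for \<open>m < p\<close> it is
  \<open>m\<close> and nothing is removed, otherwise it is \<open>Suc m\<close> and \<open>p\<close>
  is left out.\<close>

lemma skip_image_lessThan: "skip p ` {..<m} = {..<skip p m} - {p}"
proof (intro set_eqI iffI)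
  fix x assume "x \<in> {..<skip p m} - {p}"
  then have "x = skip p (if x < p then x else x - 1)" "(if x < p then x else x - 1) < m"
    by (auto simp: skip_def split: if_splits)
  then show "x \<in> skip p ` {..<m}" by blast
qed (auto simp: skip_def split: if_splits)

lemma sum_skip:
  fixes f :: "nat \<Rightarrow> real"
  assumes "f p = 0"
  shows "(\<Sum>i<m. f (skip p i)) = (\<Sum>i<skip p m. f i)"
proof -
  have "(\<Sum>i<m. f (skip p i)) = sum f ({..<skip p m} - {p})"
    using inj_on_subset[OF inj_skip subset_UNIV]
    by (simp add: sum.reindex skip_image_lessThan[symmetric])
  also have "\<dots> = (\<Sum>i<skip p m. f i)"
    using assms by (intro sum.mono_neutral_left) auto
  finally show ?thesis .
qed

text \<open>The source occupies label 0, so the relay labelled \<open>p\<close> has index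
  \<open>p - 1\<close> in \<open>os\<close>. The case \<open>i = length os\<close> is the
  destination of the shortened order.\<close>

lemma node_remove:
  assumes "p \<in> {1..length os}" "i \<le> length os"
  shows "node s d (take (p - 1) os @ drop p os) i = node s d os (skip p i)"
proof -
  obtain q where p: "p = Suc q" using assms by (cases p) auto
  show ?thesis
    using assms unfolding p node_def skip_def
    by (cases i) (auto simp: nth_append nth_Cons')
qed

text \<open>On the diagonal, a silent relay has a stage of length zero and contributes nothing to
  any later node. Each constraint of the shortened order is thus an original one with a zero term
  omitted.\<close>

lemma lp_feasible_remove_silent:
  assumes feas: "lp_feasible C Imax s d os (diag b) b"
    and p: "p \<in> {1..length os}" and silent: "b p = 0"
  defines "os' \<equiv> take (p - 1) os @ drop p os"
  shows "lp_feasible C Imax s d os' (diag (b \<circ> skip p)) (b \<circ> skip p)"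
    and "total_delay os' (b \<circ> skip p) = total_delay os b"
proof -
  have len: "length os' + 1 = length os" using p by (auto simp: os'_def)
  have node': "node s d os' i = node s d os (skip p i)" if "i \<le> length os" for i
    unfolding os'_def using p that by (rule node_remove)
  show "lp_feasible C Imax s d os' (diag (b \<circ> skip p)) (b \<circ> skip p)"
    unfolding lp_feasible_diag_iff
  proof (intro conjI ballI allI impI)
    fix m assume m: "m \<in> {1..length os' + 1}"
    have "(\<Sum>i<m. (b \<circ> skip p) i * C (node s d os' i) (node s d os' m)) =
          (\<Sum>i<m. b (skip p i) * C (node s d os (skip p i)) (node s d os (skip p m)))"
      using m len by (intro sum.cong) (auto simp: node')
    also have "\<dots> = (\<Sum>i<skip p m. b i * C (node s d os i) (node s d os (skip p m)))"
      using silent by (intro sum_skip) simp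
    also have "\<dots> \<ge> Imax"
    proof -
      have "skip p m \<in> {1..length os + 1}" using m len by (auto simp: skip_def)
      then show ?thesis using feas unfolding lp_feasible_diag_iff by blast
    qed
    finally show "Imax \<le> (\<Sum>i<m. (b \<circ> skip p) i * C (node s d os' i) (node s d os' m))" .
  next
    fix j assume "j \<le> length os'"
    then have "skip p j \<le> length os" using len by (auto simp: skip_def)
    then show "0 \<le> (b \<circ> skip p) j" using feas unfolding lp_feasible_diag_iff by simp
  qed
  \<comment> \<open>The shortened order has exactly \<open>length os\<close> stages, and this bound
    turns their sum into the sum over all original stages.\<close>
  have "skip p (length os) = Suc (length os)" using p by (auto simp: skip_def)
  then show "total_delay os' (b \<circ> skip p) = total_delay os b"
    unfolding total_delay_def atLeast0AtMost lessThan_Suc_atMost[symmetric]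
    using sum_skip[of b p "length os", OF silent] len by simp
qed

theorem theorem1:
  fixes relays :: "'a set" and s d :: 'a
    and C :: "'a \<Rightarrow> 'a \<Rightarrow> real" and Imax :: real
  assumes "finite relays"
    and "s \<notin> relays" and "d \<notin> relays" and "s \<noteq> d"
    and "\<forall>i\<in>insert s (insert d relays). \<forall>j\<in>insert s (insert d relays). i \<noteq> j \<longrightarrow> C i j \<ge> 0"
    and "Imax > 0"
    and "\<exists>R os A \<Delta>. optimal_solution relays C Imax s d R os A \<Delta>"
  shows "\<exists>R_opt O_opt A \<Delta> k.
           optimal_solution relays C Imax s d R_opt O_opt A \<Delta> \<and>
           card R_opt = k \<and>
           (\<forall>i\<in>{1..k}. (\<Sum>j=0..k. A i j) \<noteq> 0) \<and>
           (\<forall>j\<in>{0..k}. \<forall>i\<in>{0..k}. i \<noteq> j \<longrightarrow> A i j = 0)"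
proof -
  \<comment> \<open>Hiding \<open>b\<close> leaves a predicate on the order alone, whose length can
    then be minimized.\<close>
  define opt_diag where
    "opt_diag os \<longleftrightarrow> (\<exists>b. optimal_solution relays C Imax s d (set os) os (diag b) b)" for os
  have improve: "optimal_solution relays C Imax s d R' os' A' \<Delta>'"
    if "optimal_solution relays C Imax s d R os A \<Delta>"
      "feasible_solution relays C Imax s d R' os' A' \<Delta>'"
      "total_delay os' \<Delta>' \<le> total_delay os \<Delta>" for R R' os os' A A' \<Delta> \<Delta>'
    using that unfolding optimal_solution_def by (meson order_trans)
  obtain R os0 A \<Delta> where opt0: "optimal_solution relays C Imax s d R os0 A \<Delta>"
    using assms(7) by blast
  then have R: "R = set os0" "set os0 \<subseteq> relays" "distinct os0"
    and feas0: "lp_feasible C Imax s d os0 A \<Delta>"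
    by (auto simp: optimal_solution_def feasible_solution_def relay_ordering_def)
  have "C (node s d os0 i) (node s d os0 m) \<ge> 0" if "i < m" "m \<le> length os0 + 1" for i m
  proof -
    \<comment> \<open>Capacities are assumed non-negative only between distinct nodes, so distinct
      labels must be shown to denote distinct nodes.\<close>
    have neq: "node s d os0 i \<noteq> node s d os0 m"
      using node_inject[of os0 s d i m] that R assms(2,3,4) by auto
    have "node s d os0 j \<in> insert s (insert d relays)" if "j \<le> length os0 + 1" for j
      using node_in_nodes[OF that] R by auto
    then have "node s d os0 i \<in> insert s (insert d relays)"
      "node s d os0 m \<in> insert s (insert d relays)"
      using that by simp_all
    with neq show ?thesis by (intro assms(5)[rule_format])
  qed
  note diagonal = lp_feasible_diagonalize[OF feas0 this]
  have "opt_diag os0"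
    unfolding opt_diag_def
    using improve[OF opt0 _ diagonal(2)] diagonal(1) R
    by (auto simp: feasible_solution_def relay_ordering_def)
  then obtain os where "opt_diag os" and minimal: "\<And>os'. opt_diag os' \<Longrightarrow> length os \<le> length os'"
    using ex_has_least_nat[of opt_diag os0 length] by blast
  then obtain b where opt: "optimal_solution relays C Imax s d (set os) os (diag b) b"
    unfolding opt_diag_def by blast
  then have os: "set os \<subseteq> relays" "distinct os" and feas: "lp_feasible C Imax s d os (diag b) b"
    by (auto simp: optimal_solution_def feasible_solution_def relay_ordering_def)
  have transmits: "b p \<noteq> 0" if p: "p \<in> {1..length os}" for p
  proof
    assume silent: "b p = 0"
    let ?os = "take (p - 1) os @ drop p os"
    note remove = lp_feasible_remove_silent[OF feas p silent]
    have "set ?os \<subseteq> relays"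
      using os set_take_subset[of "p - 1" os] set_drop_subset[of p os] by auto
    moreover have "distinct ?os"
      using os set_take_disj_set_drop_if_distinct[of os "p - 1" p] by auto
    ultimately have "feasible_solution relays C Imax s d (set ?os) ?os
        (diag (b \<circ> skip p)) (b \<circ> skip p)"
      using remove(1) by (simp add: feasible_solution_def relay_ordering_def)
    then have "opt_diag ?os"
      unfolding opt_diag_def using improve[OF opt] remove(2) by (metis order_refl)
    \<comment> \<open>The new order is optimal with equal delay but has one relay fewer.\<close>
    from minimal[OF this] show False using p by auto
  qed
  have "(\<Sum>j=0..length os. diag b i j) \<noteq> 0" if "i \<in> {1..length os}" for i
    using transmits[OF that] that by (simp add: diag_def)
  then show ?thesis
    using opt distinct_card[OF os(2)]
    by (intro exI[of _ "set os"] exI[of _ os] exI[of _ "diag b"] exI[of _ b] exI[of _ "length os"])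
      (simp add: diag_def)
qed

end
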